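(* Let $\Gamma$ be a distance-biregular graph on $n$ vertices with stable sets $V_0,V_1$. Then for each $y\in V_\ell$, $\ell\in\{0,1\}$, and each $x\in V$, the group inverse of the Laplacian matrix $\mathsf L$ satisfies $$\mathsf L^\#(x,y)=\frac1n\sum_{j=d(x,y)+1}^{D_\ell}\frac{n-B_{\ell,j-1}}{k_{\ell,j}c_{\ell,j}}-\frac1{n^2}\sum_{j=1}^{D_\ell}\frac{B_{\ell,j-1}(n-B_{\ell,j-1})}{k_{\ell,j}c_{\ell,j}}.$$
   Context: Graphs are finite, connected, simple, $n=|V|\ge2$, $d$ the graph distance, $\Gamma_i(x)=\{y:d(x,y)=i\}$. $\mathsf L$ is the combinatorial Laplacian matrix (degree diagonal matrix minus adjacency matrix) and $\mathsf L^\#$ its group inverse (the unique matrix $X$ with $\mathsf LX\mathsf L=\mathsf L$, $X\mathsf LX=X$, $\mathsf LX=X\mathsf L$). A distance-biregular graph is a connected bipartite graph with stable sets $V_0,V_1$, every vertex in $V_\ell$ of degree $k_\ell$, such that for vertices $x,y$ at distance $i$ the numbers $|\Gamma_{i-1}(x)\cap\Gamma_1(y)|$ and $|\Gamma_{i+1}(x)\cap\Gamma_1(y)|$ depend only on $i$ and the stable set $V_\ell$ of $x$; they are denoted $c_{\ell,i}$, $b_{\ell,i}$. $D_\ell=\max\{d(x,y):x\in V_\ell,y\in V\}$; for $x\in V_\ell$, $k_{\ell,i}=|\Gamma_i(x)|$ and $B_{\ell,i}=\sum_{j=0}^ik_{\ell,j}$. An empty sum equals $0$. *)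

theory Defs
  imports "HOL-Analysis.Analysis"
begin

text \<open>
  A graph has vertex set \<open>UNIV :: 'v set\<close> for a finite type \<open>'v\<close> and is given by its
  adjacency relation \<open>E\<close>; its order is \<open>CARD('v)\<close>.
\<close>

definition simple_graph :: "('v::finite \<Rightarrow> 'v \<Rightarrow> bool) \<Rightarrow> bool" where
  "simple_graph E \<longleftrightarrow> symp E \<and> irreflp E"

definition connected_graph :: "('v::finite \<Rightarrow> 'v \<Rightarrow> bool) \<Rightarrow> bool" where
  "connected_graph E \<longleftrightarrow> (\<forall>x y. E\<^sup>*\<^sup>* x y)"

text \<open>Length of a shortest walk; meaningful only if \<open>y\<close> is reachable from \<open>x\<close>.\<close>

definition gdist :: "('v::finite \<Rightarrow> 'v \<Rightarrow> bool) \<Rightarrow> 'v \<Rightarrow> 'v \<Rightarrow> nat" where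
  "gdist E x y = (LEAST m. (E ^^ m) x y)"

definition Gam :: "('v::finite \<Rightarrow> 'v \<Rightarrow> bool) \<Rightarrow> nat \<Rightarrow> 'v \<Rightarrow> 'v set" where
  "Gam E i x = {y. gdist E x y = i}"

definition vdegree :: "('v::finite \<Rightarrow> 'v \<Rightarrow> bool) \<Rightarrow> 'v \<Rightarrow> nat" where
  "vdegree E x = card {y. E x y}"

definition degree_matrix :: "('v::finite \<Rightarrow> 'v \<Rightarrow> bool) \<Rightarrow> real^'v^'v" where
  "degree_matrix E = (\<chi> x y. if x = y then real (vdegree E x) else 0)"

definition adjacency_matrix :: "('v::finite \<Rightarrow> 'v \<Rightarrow> bool) \<Rightarrow> real^'v^'v" where
  "adjacency_matrix E = (\<chi> x y. if E x y then 1 else 0)"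

definition laplacian :: "('v::finite \<Rightarrow> 'v \<Rightarrow> bool) \<Rightarrow> real^'v^'v" where
  "laplacian E = degree_matrix E - adjacency_matrix E"

definition is_group_inverse :: "real^'v^'v \<Rightarrow> real^'v^'v \<Rightarrow> bool" where
  "is_group_inverse A X \<longleftrightarrow> A ** X ** A = A \<and> X ** A ** X = X \<and> A ** X = X ** A"

definition group_inverse :: "real^'v^'v \<Rightarrow> real^'v^'v" where
  "group_inverse A = (THE X. is_group_inverse A X)"

lemma is_group_inverse_unique:
  fixes A :: "real^'v^'v"
  assumes "is_group_inverse A X" "is_group_inverse A Y"
  shows "X = Y"
proof -
  have X: "A ** X ** A = A" "X ** A ** X = X" "A ** X = X ** A"
    and Y: "A ** Y ** A = A" "Y ** A ** Y = Y" "A ** Y = Y ** A"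
    using assms by (auto simp: is_group_inverse_def)
  have "A ** X = A ** Y ** (A ** X)"
    by (metis Y(1) matrix_mul_assoc)
  moreover have "A ** Y = A ** Y ** (A ** X)"
    by (metis X(1,3) Y(3) matrix_mul_assoc)
  ultimately have e: "A ** X = A ** Y" by simp
  have "X = X ** (A ** X)" by (metis X(2) matrix_mul_assoc)
  also have "\<dots> = X ** A ** Y" by (simp add: e matrix_mul_assoc)
  also have "\<dots> = Y ** A ** Y" using e X(3) Y(3) by simp
  finally show ?thesis by (simp add: Y(2))
qed

text \<open>
  The stable sets are \<open>V 0\<close> and \<open>V 1\<close>; other values of \<open>V\<close> are irrelevant.
  For \<open>i = 0\<close> the truncated subtraction is harmless: \<open>\<Gamma>\<^sub>0(x) \<inter> \<Gamma>\<^sub>1(x)\<close> is empty,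
  as is \<open>\<Gamma>\<^sub>-\<^sub>1(x)\<close>.
\<close>

definition distance_biregular :: "('v::finite \<Rightarrow> 'v \<Rightarrow> bool) \<Rightarrow> (nat \<Rightarrow> 'v set) \<Rightarrow> bool" where
  "distance_biregular E V \<longleftrightarrow>
     simple_graph E \<and> connected_graph E \<and>
     V 0 \<union> V 1 = UNIV \<and> V 0 \<inter> V 1 = {} \<and>
     (\<forall>l\<in>{0,1}. \<forall>x\<in>V l. \<forall>y\<in>V l. \<not> E x y) \<and>
     (\<forall>l\<in>{0,1}. \<exists>k. \<forall>x\<in>V l. vdegree E x = k) \<and>
     (\<forall>l\<in>{0,1}. \<forall>i. \<exists>c. \<forall>x\<in>V l. \<forall>y. gdist E x y = i \<longrightarrow>
        card (Gam E (i - 1) x \<inter> Gam E 1 y) = c) \<and>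
     (\<forall>l\<in>{0,1}. \<forall>i. \<exists>b. \<forall>x\<in>V l. \<forall>y. gdist E x y = i \<longrightarrow>
        card (Gam E (i + 1) x \<inter> Gam E 1 y) = b)"

definition diam_part :: "('v::finite \<Rightarrow> 'v \<Rightarrow> bool) \<Rightarrow> (nat \<Rightarrow> 'v set) \<Rightarrow> nat \<Rightarrow> nat" where
  "diam_part E V l = Max {gdist E x y |x y. x \<in> V l}"

text \<open>
  For a distance-biregular graph with at least two vertices, the value described in \<open>c_num\<close>
  is unique for \<open>i \<le> diam_part E V l\<close>, and the one in \<open>k_num\<close> for every \<open>i\<close>.
\<close>

definition c_num :: "('v::finite \<Rightarrow> 'v \<Rightarrow> bool) \<Rightarrow> (nat \<Rightarrow> 'v set) \<Rightarrow> nat \<Rightarrow> nat \<Rightarrow> nat" where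
  "c_num E V l i = (THE c. \<forall>x\<in>V l. \<forall>y. gdist E x y = i \<longrightarrow>
     card (Gam E (i - 1) x \<inter> Gam E 1 y) = c)"

definition k_num :: "('v::finite \<Rightarrow> 'v \<Rightarrow> bool) \<Rightarrow> (nat \<Rightarrow> 'v set) \<Rightarrow> nat \<Rightarrow> nat \<Rightarrow> nat" where
  "k_num E V l i = (THE k. \<forall>x\<in>V l. card (Gam E i x) = k)"

definition B_num :: "('v::finite \<Rightarrow> 'v \<Rightarrow> bool) \<Rightarrow> (nat \<Rightarrow> 'v set) \<Rightarrow> nat \<Rightarrow> nat \<Rightarrow> nat" where
  "B_num E V l i = (\<Sum>j=0..i. k_num E V l j)"

end

theory Submission
  imports Defs
begin

text \<open>
  Fix \<open>y \<in> V\<^sub>\<ell>\<close>. A function \<open>f (d(y,x))\<close> of the distance to \<open>y\<close> is mapped by the Laplacian to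
  \<open>c\<^sub>i (f i - f (i-1)) + b\<^sub>i (f i - f (i+1))\<close>, because a neighbour of a vertex at distance \<open>i\<close>
  lies at distance \<open>i - 1\<close> or \<open>i + 1\<close> by bipartiteness. Counting edges between consecutive spheres
  gives \<open>k\<^sub>i b\<^sub>i = k\<^sub>i\<^sub>+\<^sub>1 c\<^sub>i\<^sub>+\<^sub>1\<close>, so that the first sum of the formula solves
  \<open>L u = e\<^sub>y - 1/n\<close> by telescoping; the second sum is its mean. The matrix \<open>G\<close> of these columns thus
  satisfies \<open>L G = I - J/n\<close> and \<open>J G = 0\<close>, and as \<open>L\<close> is symmetric with \<open>L J = 0\<close>, this forces
  \<open>G\<close> to be symmetric and the group inverse of \<open>L\<close>.
\<close>

section \<open>Group inverses of symmetric matrices\<close>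

lemma group_inverse_eqI:
  assumes "is_group_inverse A X"
  shows "group_inverse A = X"
  unfolding group_inverse_def
proof (rule the_equality)
  show "Y = X" if "is_group_inverse A Y" for Y
    using that assms by (rule is_group_inverse_unique)
qed (rule assms)

text \<open>Symmetry of \<open>G\<close> need not be assumed. Transposing \<open>L ** G = P\<close>
  gives \<open>transpose G ** L = P\<close>, so bracketing \<open>transpose G ** L ** G\<close> in
  both ways yields \<open>transpose G = G\<close>. Hence \<open>G\<close> commutes with
  \<open>L\<close>.\<close>

lemma symmetric_group_inverseI:
  fixes L G P :: "real^'v^'v"
  assumes L: "transpose L = L" and P: "transpose P = P"
    and LP: "L ** P = L" and LG: "L ** G = P" and PG: "P ** G = G"
  shows "group_inverse L = G"
proof -
  have tGL: "transpose G ** L = P"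
    by (metis L LG P matrix_transpose_mul)
  have "transpose G = transpose G ** P"
    by (metis P PG matrix_transpose_mul)
  also have "\<dots> = transpose G ** L ** G"
    by (simp add: LG flip: matrix_mul_assoc)
  also have "\<dots> = G"
    by (simp add: tGL PG)
  finally have "G ** L = P"
    using tGL by simp
  moreover have "P ** L = L"
    by (metis L LP P matrix_transpose_mul)
  ultimately have "is_group_inverse L G"
    by (simp add: is_group_inverse_def LG PG)
  then show ?thesis
    by (rule group_inverse_eqI)
qed

section \<open>Distance in connected graphs\<close>

locale connected_simple_graph =
  fixes E :: "'v::finite \<Rightarrow> 'v \<Rightarrow> bool"
  assumes simple: "simple_graph E" and connected: "connected_graph E"
begin

lemma adj_sym: "E x y \<Longrightarrow> E y x"
  using simple by (auto simp: simple_graph_def dest: sympD)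

lemma adj_commute: "E x y \<longleftrightarrow> E y x"
  using adj_sym by blast

lemma adj_irrefl: "\<not> E x x"
  using simple by (auto simp: simple_graph_def dest: irreflpD)

lemma relpowp_gdist: "(E ^^ gdist E x y) x y"
proof -
  have "\<exists>m. (E ^^ m) x y"
    using connected by (auto simp: connected_graph_def rtranclp_power)
  then show ?thesis
    unfolding gdist_def by (rule LeastI_ex)
qed

lemma gdist_le: "(E ^^ m) x y \<Longrightarrow> gdist E x y \<le> m"
  unfolding gdist_def by (rule Least_le)

lemma relpowp_adj_sym: "(E ^^ m) x y \<Longrightarrow> (E ^^ m) y x"
proof (induction m arbitrary: y)
  case (Suc m)
  from Suc.prems obtain z where "(E ^^ m) x z" "E z y"
    by (rule relpowp_Suc_E)
  then show ?case
    using Suc.IH adj_sym relpowp_Suc_I2 by metis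
qed auto

lemma gdist_sym: "gdist E x y = gdist E y x"
  by (intro antisym gdist_le relpowp_adj_sym[OF relpowp_gdist])

lemma gdist_eq_0_iff [simp]: "gdist E x y = 0 \<longleftrightarrow> x = y"
  using relpowp_gdist[of x y] gdist_le[of 0 x y] by auto

lemma gdist_adj_le: "E x z \<Longrightarrow> gdist E y z \<le> Suc (gdist E y x)"
  by (rule gdist_le[OF relpowp_Suc_I[OF relpowp_gdist]])

lemma gdist_eq_1_iff: "gdist E x y = 1 \<longleftrightarrow> E x y"
proof
  assume "gdist E x y = 1"
  then show "E x y"
    using relpowp_gdist[of x y] by (simp add: eq_OO)
next
  assume "E x y"
  then have "gdist E x y \<le> 1 \<and> gdist E x y \<noteq> 0"
    using gdist_adj_le[of x y x] gdist_eq_0_iff[of x x] gdist_eq_0_iff[of x y] adj_irrefl[of x]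
    by (simp, metis)
  then show "gdist E x y = 1"
    by linarith
qed

lemma mem_Gam: "z \<in> Gam E i y \<longleftrightarrow> gdist E y z = i"
  by (simp add: Gam_def)

lemma mem_Gam_1: "z \<in> Gam E 1 x \<longleftrightarrow> E x z"
  by (simp add: mem_Gam gdist_eq_1_iff del: One_nat_def)

lemma gdist_Suc_predecessor:
  assumes "gdist E y x = Suc i"
  obtains z where "E z x" "gdist E y z = i"
proof -
  have "(E ^^ Suc i) y x"
    using relpowp_gdist[of y x] assms by simp
  then obtain z where z: "(E ^^ i) y z" "E z x"
    by (rule relpowp_Suc_E)
  have "gdist E y z = i"
    using gdist_le[OF z(1)] gdist_adj_le[OF z(2), of y] assms by linarith
  with z(2) show thesis
    by (rule that)
qed

text \<open>A shortest walk from \<open>y\<close> meets every smaller distance on its way; the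
  induction steps back along predecessors.\<close>

lemma Gam_nonempty_downward:
  assumes "Gam E j y \<noteq> {}" "i \<le> j"
  shows "Gam E i y \<noteq> {}"
  using assms(2,1)
proof (induction rule: inc_induct)
  case (step m)
  then obtain x where "gdist E y x = Suc m"
    by (auto simp: Gam_def)
  then show ?case
    by (elim gdist_Suc_predecessor) (auto simp: Gam_def)
qed

lemma Gam_0: "Gam E 0 y = {y}"
  by (auto simp: mem_Gam)

text \<open>Both sides count the edges joining two consecutive spheres, once from the inner end and
  once from the outer end.\<close>

lemma edges_between_spheres:
  "(\<Sum>x\<in>Gam E i y. card (Gam E (Suc i) y \<inter> Gam E 1 x)) =
   (\<Sum>z\<in>Gam E (Suc i) y. card (Gam E i y \<inter> Gam E 1 z))"
proof -
  have "card (A \<inter> Gam E 1 x) = (\<Sum>z\<in>A. if E x z then 1 else 0)" for A x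
  proof -
    have "A \<inter> Gam E 1 x = A \<inter> {z. E x z}"
      using mem_Gam_1 by blast
    then show ?thesis
      by (simp add: sum.If_cases del: One_nat_def)
  qed
  then have "(\<Sum>x\<in>Gam E i y. card (Gam E (Suc i) y \<inter> Gam E 1 x)) =
      (\<Sum>x\<in>Gam E i y. \<Sum>z\<in>Gam E (Suc i) y. if E x z then 1 else 0)"
    and "(\<Sum>z\<in>Gam E (Suc i) y. card (Gam E i y \<inter> Gam E 1 z)) =
      (\<Sum>z\<in>Gam E (Suc i) y. \<Sum>x\<in>Gam E i y. if E z x then 1 else 0)"
    by (simp_all only:)
  moreover have "(if E z x then 1 else 0) = (if E x z then 1 else (0::nat))" for x z
    using adj_commute by metis
  ultimately show ?thesis
    by (simp only: sum.swap[of _ "Gam E i y"])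
qed

lemma laplacian_mult_vec:
  "(\<Sum>z\<in>UNIV. laplacian E $ x $ z * u z) = (\<Sum>z\<in>Gam E 1 x. u x - u z)"
proof -
  have N: "Gam E 1 x = {z. E x z}"
    using mem_Gam_1 by blast
  have "(\<Sum>z\<in>UNIV. laplacian E $ x $ z * u z) =
      (\<Sum>z\<in>UNIV. (if x = z then real (vdegree E x) * u z else 0) - (if E x z then u z else 0))"
    by (rule sum.cong) (auto simp: laplacian_def degree_matrix_def adjacency_matrix_def adj_irrefl)
  also have "\<dots> = real (vdegree E x) * u x - (\<Sum>z\<in>Gam E 1 x. u z)"
    by (simp add: sum_subtractf N sum.If_cases del: One_nat_def)
  finally show ?thesis
    by (simp add: sum_subtractf N vdegree_def del: One_nat_def)
qed

lemma transpose_laplacian: "transpose (laplacian E) = laplacian E"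
  by (auto simp: adj_commute vec_eq_iff transpose_def laplacian_def degree_matrix_def adjacency_matrix_def)

end

section \<open>Distance-biregular graphs\<close>

text \<open>Companion of \<open>c_num\<close>. It is absent from the final formula because edge
  counting trades it for \<open>c_num\<close> one sphere further out.\<close>

definition b_num :: "('v::finite \<Rightarrow> 'v \<Rightarrow> bool) \<Rightarrow> (nat \<Rightarrow> 'v set) \<Rightarrow> nat \<Rightarrow> nat \<Rightarrow> nat" where
  "b_num E V l i = (THE b. \<forall>x\<in>V l. \<forall>y. gdist E x y = i \<longrightarrow>
     card (Gam E (i + 1) x \<inter> Gam E 1 y) = b)"

locale distance_biregular_graph =
  fixes E :: "'v::finite \<Rightarrow> 'v \<Rightarrow> bool" and V :: "nat \<Rightarrow> 'v set"
  assumes distance_biregular: "distance_biregular E V"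

sublocale distance_biregular_graph \<subseteq> connected_simple_graph
  using distance_biregular by unfold_locales (auto simp: distance_biregular_def)

context distance_biregular_graph
begin

section \<open>Intersection numbers and sphere sizes\<close>

context
  fixes l :: nat
  assumes l: "l \<in> {0, 1}"
begin

text \<open>The pair at distance \<open>i\<close> witnesses uniqueness of the constant; without such
  a pair the condition is vacuous and \<open>THE\<close> is unspecified.\<close>

lemma c_num_eq:
  assumes "y \<in> V l" "gdist E y x = i"
  shows "card (Gam E (i - 1) y \<inter> Gam E 1 x) = c_num E V l i"
proof -
  have "\<exists>c. \<forall>x\<in>V l. \<forall>y. gdist E x y = i \<longrightarrow> card (Gam E (i - 1) x \<inter> Gam E 1 y) = c"
    using distance_biregular l unfolding distance_biregular_def by blast
  then have "\<exists>!c. \<forall>x\<in>V l. \<forall>y. gdist E x y = i \<longrightarrow> card (Gam E (i - 1) x \<inter> Gam E 1 y) = c"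
    using assms by metis
  from theI'[OF this] show ?thesis
    using assms unfolding c_num_def by blast
qed

lemma b_num_eq:
  assumes "y \<in> V l" "gdist E y x = i"
  shows "card (Gam E (i + 1) y \<inter> Gam E 1 x) = b_num E V l i"
proof -
  have "\<exists>c. \<forall>x\<in>V l. \<forall>y. gdist E x y = i \<longrightarrow> card (Gam E (i + 1) x \<inter> Gam E 1 y) = c"
    using distance_biregular l unfolding distance_biregular_def by blast
  then have "\<exists>!c. \<forall>x\<in>V l. \<forall>y. gdist E x y = i \<longrightarrow> card (Gam E (i + 1) x \<inter> Gam E 1 y) = c"
    using assms by metis
  from theI'[OF this] show ?thesis
    using assms unfolding b_num_def by blast
qed

lemma card_Gam_Suc:
  assumes "y \<in> V l"
  shows "card (Gam E i y) * b_num E V l i = card (Gam E (Suc i) y) * c_num E V l (Suc i)"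
proof -
  have "card (Gam E i y) * b_num E V l i = (\<Sum>x\<in>Gam E i y. card (Gam E (Suc i) y \<inter> Gam E 1 x))"
    using b_num_eq[OF assms, of _ i] by (simp add: mem_Gam)
  also have "\<dots> = (\<Sum>z\<in>Gam E (Suc i) y. card (Gam E i y \<inter> Gam E 1 z))"
    by (rule edges_between_spheres)
  also have "\<dots> = card (Gam E (Suc i) y) * c_num E V l (Suc i)"
    using c_num_eq[OF assms, of _ "Suc i"] by (simp add: mem_Gam)
  finally show ?thesis .
qed

lemma c_num_pos:
  assumes "y \<in> V l" "Gam E (Suc i) y \<noteq> {}"
  shows "c_num E V l (Suc i) > 0"
proof -
  obtain x where x: "gdist E y x = Suc i"
    using assms(2) by (auto simp: Gam_def)
  then obtain z where z: "E z x" "gdist E y z = i"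
    by (rule gdist_Suc_predecessor)
  then have "z \<in> Gam E i y \<inter> Gam E 1 x"
    by (simp add: mem_Gam gdist_eq_1_iff adj_sym del: One_nat_def)
  then have "card (Gam E i y \<inter> Gam E 1 x) > 0"
    by (metis card_gt_0_iff empty_iff finite)
  then show ?thesis
    using c_num_eq[OF assms(1) x] by simp
qed

text \<open>The recurrence \<open>card_Gam_Suc\<close> determines sphere sizes outwards from the
  singleton sphere of radius 0, with coefficients depending on \<open>l\<close> alone.\<close>

lemma card_Gam_cong:
  assumes "y \<in> V l" "y' \<in> V l"
  shows "card (Gam E i y) = card (Gam E i y')"
proof (induction i)
  case 0
  show ?case by (simp add: Gam_0)
next
  case (Suc i)
  have "card (Gam E (Suc i) y) * c_num E V l (Suc i) = card (Gam E (Suc i) y') * c_num E V l (Suc i)"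
    using card_Gam_Suc[OF assms(1), of i] card_Gam_Suc[OF assms(2), of i] by (simp only: Suc)
  then show ?case
    \<comment> \<open>A positive \<open>c_num\<close> cancels; if it is 0, both spheres are
      empty.\<close>
    using c_num_pos[OF assms(1), of i] c_num_pos[OF assms(2), of i]
    by (metis bot_nat_0.not_eq_extremum mult_right_cancel)
qed

lemma k_num_eq:
  assumes "y \<in> V l"
  shows "k_num E V l i = card (Gam E i y)"
proof (unfold k_num_def, rule the_equality)
  show "\<forall>x\<in>V l. card (Gam E i x) = card (Gam E i y)"
    using card_Gam_cong assms by blast
qed (use assms in metis)

lemma k_num_Suc:
  assumes "y \<in> V l"
  shows "k_num E V l i * b_num E V l i = k_num E V l (Suc i) * c_num E V l (Suc i)"
  using card_Gam_Suc[OF assms] by (simp add: k_num_eq[OF assms])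

lemma finite_distances: "finite {gdist E x y |x y. x \<in> V l}"
  by (rule finite_subset[of _ "(\<lambda>(x, y). gdist E x y) ` UNIV"]) auto

lemma gdist_le_diam_part:
  assumes "y \<in> V l"
  shows "gdist E y x \<le> diam_part E V l"
  unfolding diam_part_def using assms by (intro Max_ge finite_distances) auto

lemma k_num_pos_iff:
  assumes "y \<in> V l"
  shows "k_num E V l i > 0 \<longleftrightarrow> i \<le> diam_part E V l"
proof
  assume "k_num E V l i > 0"
  then obtain x where "gdist E y x = i"
    by (auto simp: k_num_eq[OF assms] card_gt_0_iff Gam_def)
  then show "i \<le> diam_part E V l"
    using gdist_le_diam_part[OF assms] by blast
next
  assume i: "i \<le> diam_part E V l"
  \<comment> \<open>The maximum may be attained from a vertex \<open>y'\<close> other than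
    \<open>y\<close>; this is harmless, since \<open>k_num\<close> gives the sphere sizes around
    both.\<close>
  have "diam_part E V l \<in> {gdist E x y |x y. x \<in> V l}"
    unfolding diam_part_def using assms by (intro Max_in finite_distances) auto
  then obtain y' x where y': "y' \<in> V l" "gdist E y' x = diam_part E V l"
    by auto
  then have "Gam E (diam_part E V l) y' \<noteq> {}"
    by (auto simp: Gam_def)
  then have "Gam E i y' \<noteq> {}"
    using i by (rule Gam_nonempty_downward)
  then show "k_num E V l i > 0"
    by (simp add: k_num_eq[OF y'(1)] card_gt_0_iff)
qed

lemma sum_over_spheres:
  fixes f :: "nat \<Rightarrow> real"
  assumes "y \<in> V l"
  shows "(\<Sum>x\<in>UNIV. f (gdist E y x)) = (\<Sum>i=0..diam_part E V l. real (k_num E V l i) * f i)"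
proof -
  have "(\<Sum>x\<in>UNIV. f (gdist E y x)) =
      (\<Sum>i=0..diam_part E V l. \<Sum>x\<in>{x\<in>UNIV. gdist E y x = i}. f (gdist E y x))"
    using gdist_le_diam_part[OF assms] by (intro sum.group[symmetric]) auto
  also have "\<dots> = (\<Sum>i=0..diam_part E V l. real (k_num E V l i) * f i)"
    by (simp add: k_num_eq[OF assms] Gam_def)
  finally show ?thesis .
qed

lemma B_num_diam_part:
  assumes "y \<in> V l"
  shows "B_num E V l (diam_part E V l) = CARD('v)"
proof -
  have "real (B_num E V l (diam_part E V l)) = real CARD('v)"
    using sum_over_spheres[OF assms, of "\<lambda>_. 1"] by (simp add: B_num_def)
  then show ?thesis
    by simp
qed

section \<open>Parity of distances and the Laplacian on radial functions\<close>

lemma adj_mem_part_iff: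
  assumes "E x z"
  shows "z \<in> V l \<longleftrightarrow> x \<notin> V l"
proof -
  have "V 0 \<union> V 1 = UNIV" "\<forall>l\<in>{0,1}. \<forall>x\<in>V l. \<forall>y\<in>V l. \<not> E x y"
    using distance_biregular unfolding distance_biregular_def by simp_all
  then show ?thesis
    using assms l by blast
qed

lemma even_gdist_iff:
  assumes "y \<in> V l"
  shows "even (gdist E y x) \<longleftrightarrow> x \<in> V l"
proof (induction "gdist E y x" arbitrary: x)
  case 0
  then show ?case
    using assms by (metis even_zero gdist_eq_0_iff)
next
  case (Suc i)
  obtain z where z: "E z x" "gdist E y z = i"
    using Suc(2)[symmetric] by (rule gdist_Suc_predecessor)
  then show ?case
    using Suc(1)[of z] Suc(2) adj_mem_part_iff[OF z(1)] by (metis even_Suc)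
qed

text \<open>Adjacent vertices lie in different stable sets, so their distances to \<open>y\<close>
  differ in parity and cannot be equal.\<close>

lemma gdist_adj_cases:
  assumes "y \<in> V l" "E x z"
  shows "gdist E y z = Suc (gdist E y x) \<or> gdist E y x = Suc (gdist E y z)"
proof -
  have "gdist E y z \<noteq> gdist E y x"
    using even_gdist_iff[OF assms(1), of x] even_gdist_iff[OF assms(1), of z]
      adj_mem_part_iff[OF assms(2)] by metis
  then show ?thesis
    using gdist_adj_le[OF assms(2), of y] gdist_adj_le[OF adj_sym[OF assms(2)], of y] by linarith
qed

text \<open>The neighbours of \<open>x\<close> split into those one step closer to \<open>y\<close>
  and those one step further away. At \<open>i = 0\<close> truncation makes \<open>f (i - 1)\<close>
  equal to \<open>f i\<close>, so the first term vanishes.\<close>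

lemma laplacian_radial:
  fixes f :: "nat \<Rightarrow> real"
  assumes "y \<in> V l" and i: "gdist E y x = i"
  shows "(\<Sum>z\<in>UNIV. laplacian E $ x $ z * f (gdist E y z)) =
    real (c_num E V l i) * (f i - f (i - 1)) + real (b_num E V l i) * (f i - f (i + 1))"
proof -
  let ?C = "Gam E (i - 1) y \<inter> Gam E 1 x" and ?B = "Gam E (i + 1) y \<inter> Gam E 1 x"
  have "Gam E 1 x = ?C \<union> ?B"
    using gdist_adj_cases[OF assms(1), of x] i
    by (force simp: mem_Gam gdist_eq_1_iff simp del: One_nat_def)
  moreover have "?C \<inter> ?B = {}"
    by (auto simp: mem_Gam)
  ultimately have "(\<Sum>z\<in>Gam E 1 x. f i - f (gdist E y z)) =
      (\<Sum>z\<in>?C. f i - f (gdist E y z)) + (\<Sum>z\<in>?B. f i - f (gdist E y z))"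
    by (metis (no_types, lifting) finite sum.union_disjoint)
  also have "\<dots> = (\<Sum>z\<in>?C. f i - f (i - 1)) + (\<Sum>z\<in>?B. f i - f (i + 1))"
    by (intro arg_cong2[where f = "(+)"] sum.cong) (auto simp: mem_Gam)
  also have "\<dots> = real (c_num E V l i) * (f i - f (i - 1)) + real (b_num E V l i) * (f i - f (i + 1))"
    using c_num_eq[OF assms] b_num_eq[OF assms] by (simp del: One_nat_def)
  finally show ?thesis
    by (subst laplacian_mult_vec) (simp add: i del: One_nat_def)
qed

end

section \<open>The radial Green function\<close>

abbreviation green_step :: "nat \<Rightarrow> nat \<Rightarrow> real" where
  "green_step l j \<equiv> (real CARD('v) - real (B_num E V l (j - 1)))
     / (real (k_num E V l j) * real (c_num E V l j))"

text \<open>Potential of a flow in which every vertex other than the source absorbs one unit. The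
  \<open>n - B_num E V l (j - 1)\<close> units needed at distance at least \<open>j\<close> are
  spread evenly over the \<open>k_num * c_num\<close> edges entering sphere \<open>j\<close>, so
  \<open>green_step l j\<close> is the flow per edge. The potential is 0 at the largest
  distance.\<close>

definition green_potential :: "nat \<Rightarrow> nat \<Rightarrow> real" where
  "green_potential l i = (\<Sum>j = i + 1..diam_part E V l. green_step l j)"

lemma green_potential_diff:
  assumes "i < diam_part E V l"
  shows "green_potential l i - green_potential l (Suc i) = green_step l (Suc i)"
  unfolding green_potential_def
  using sum.atLeast_Suc_atMost[of "Suc i" "diam_part E V l" "green_step l"] assms by simp

context
  fixes l :: nat and y :: 'v
  assumes l: "l \<in> {0, 1}" and y: "y \<in> V l"
begin

lemma green_step_flux:
  assumes "i < diam_part E V l"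
  shows "real (k_num E V l (Suc i)) * real (c_num E V l (Suc i)) * green_step l (Suc i)
    = real CARD('v) - real (B_num E V l i)"
proof -
  have k: "k_num E V l (Suc i) > 0"
    using k_num_pos_iff[OF l y] assms by simp
  then have "Gam E (Suc i) y \<noteq> {}"
    by (auto simp: k_num_eq[OF l y])
  then have "c_num E V l (Suc i) > 0"
    by (rule c_num_pos[OF l y])
  with k show ?thesis
    by simp
qed

text \<open>The total flow leaving sphere \<open>i\<close> supplies exactly the vertices beyond
  it.\<close>

lemma green_potential_outflow:
  assumes "i \<le> diam_part E V l"
  shows "real (k_num E V l i) * real (b_num E V l i) *
      (green_potential l i - green_potential l (i + 1)) = real CARD('v) - real (B_num E V l i)"
proof -
  have kb: "real (k_num E V l i) * real (b_num E V l i) =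
      real (k_num E V l (Suc i)) * real (c_num E V l (Suc i))"
    by (simp only: k_num_Suc[OF l y] flip: of_nat_mult)
  show ?thesis
  proof (cases "i < diam_part E V l")
    case True
    then show ?thesis
      using green_potential_diff[OF True] green_step_flux[OF True] kb by simp
  next
    case False
    then have i: "i = diam_part E V l"
      using assms by simp
    \<comment> \<open>At the outermost sphere both sides are 0: the unspecified \<open>c_num\<close>
      beyond the diameter is multiplied by 0, and \<open>B_num\<close> has reached the order of the
      graph.\<close>
    then have "k_num E V l (Suc i) = 0"
      using k_num_pos_iff[OF l y, of "Suc i"] by simp
    then show ?thesis
      using kb B_num_diam_part[OF l y] i by simp
  qed
qed

lemma laplacian_green_potential:
  "(\<Sum>z\<in>UNIV. laplacian E $ x $ z * green_potential l (gdist E y z)) =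
   (if x = y then real CARD('v) else 0) - 1"
proof -
  define i where "i = gdist E y x"
  have iD: "i \<le> diam_part E V l"
    using gdist_le_diam_part[OF l y] by (simp add: i_def)
  let ?k = "real (k_num E V l i)"
  let ?S = "\<Sum>z\<in>UNIV. laplacian E $ x $ z * green_potential l (gdist E y z)"
  have k: "?k \<noteq> 0"
    using k_num_pos_iff[OF l y, of i] iD by simp
  \<comment> \<open>Weighting by the sphere size turns the coefficients into edge counts, so the
    terms become total flows between spheres.\<close>
  have "?k * ?S = ?k * real (c_num E V l i) * (green_potential l i - green_potential l (i - 1))
      + ?k * real (b_num E V l i) * (green_potential l i - green_potential l (i + 1))"
    by (subst laplacian_radial[OF l y i_def[symmetric]]) (simp add: algebra_simps)
  also have "\<dots> = ?k * real (c_num E V l i) * (green_potential l i - green_potential l (i - 1))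
      + (real CARD('v) - real (B_num E V l i))"
    by (simp only: green_potential_outflow[OF iD])
  also have "\<dots> = ?k * ((if x = y then real CARD('v) else 0) - 1)"
  proof (cases i)
    \<comment> \<open>At the source there is no inflow, and the outflow is
      \<open>n - B_num E V l 0 = n - 1\<close>.\<close>
    case 0
    then have "x = y"
      by (simp add: i_def)
    moreover have "k_num E V l 0 = 1"
      by (simp add: k_num_eq[OF l y] Gam_0)
    ultimately show ?thesis
      using 0 by (simp add: B_num_def)
  next
    case (Suc m)
    then have "x \<noteq> y"
      unfolding i_def using gdist_eq_0_iff[of y x] by auto
    have m: "m < diam_part E V l"
      using iD Suc by simp
    \<comment> \<open>Inflow enters with a negative sign; adding the outflow leaves
      \<open>B_num E V l m - B_num E V l i\<close>, which is minus the sphere size.\<close>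
    have "?k * real (c_num E V l i) * (green_potential l i - green_potential l (i - 1)) =
        - (real CARD('v) - real (B_num E V l m))"
      using green_potential_diff[OF m] green_step_flux[OF m] Suc
      by (simp add: algebra_simps)
    moreover have "B_num E V l i = B_num E V l m + k_num E V l i"
      by (simp add: B_num_def Suc)
    ultimately show ?thesis
      using \<open>x \<noteq> y\<close> by simp
  qed
  finally show ?thesis
    using k by simp
qed

lemma sum_green_potential:
  "(\<Sum>x\<in>UNIV. green_potential l (gdist E y x)) =
   (\<Sum>j = 1..diam_part E V l. real (B_num E V l (j - 1)) * green_step l j)"
proof -
  let ?D = "diam_part E V l"
  \<comment> \<open>Both sides range over the pairs with \<open>0 \<le> i < j \<le> D\<close>;
    afterwards the inner sum of the \<open>k_num\<close> is a \<open>B_num\<close>.\<close>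
  have swap: "(\<Sum>i=0..D. \<Sum>j = i + 1..D. g i j) = (\<Sum>j = 1..D. \<Sum>i = 0..j - 1. g i j)"
    for g :: "nat \<Rightarrow> nat \<Rightarrow> real" and D :: nat
    by (simp add: sum.Sigma)
       (rule sum.reindex_bij_witness[where i = "\<lambda>(j, i). (i, j)" and j = "\<lambda>(i, j). (j, i)"], auto)
  have "(\<Sum>x\<in>UNIV. green_potential l (gdist E y x)) =
      (\<Sum>i=0..?D. \<Sum>j = i + 1..?D. real (k_num E V l i) * green_step l j)"
    unfolding sum_over_spheres[OF l y, of "green_potential l"]
    by (simp only: green_potential_def sum_distrib_left)
  also have "\<dots> = (\<Sum>j = 1..?D. \<Sum>i = 0..j - 1. real (k_num E V l i) * green_step l j)"
    by (rule swap)
  also have "\<dots> = (\<Sum>j = 1..?D. real (B_num E V l (j - 1)) * green_step l j)"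
    by (simp only: B_num_def of_nat_sum sum_distrib_right)
  finally show ?thesis .
qed

end

section \<open>The Green matrix and the group inverse\<close>

definition part_of :: "'v \<Rightarrow> nat" where
  "part_of y = (if y \<in> V 0 then 0 else 1)"

lemma part_of_eq:
  assumes "l \<in> {0, 1}" "y \<in> V l"
  shows "part_of y = l"
  using assms distance_biregular unfolding distance_biregular_def part_of_def by auto

lemma part_of: "part_of y \<in> {0, 1}" "y \<in> V (part_of y)"
  using distance_biregular unfolding distance_biregular_def part_of_def by auto

text \<open>Each column uses the parameters of its own stable set, so symmetry is not visible here.
  The subtracted constant is the column mean.\<close>

definition green_matrix :: "real^'v^'v" where
  "green_matrix = (\<chi> x y. 1 / real CARD('v) * green_potential (part_of y) (gdist E y x)
     - 1 / (real CARD('v))\<^sup>2 * (\<Sum>z\<in>UNIV. green_potential (part_of y) (gdist E y z)))"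

text \<open>The orthogonal projection \<open>I - J/n\<close> onto the vectors with entry sum
  0.\<close>

definition mean_free_projection :: "real^'v^'v" where
  "mean_free_projection = (\<chi> x y. (if x = y then 1 else 0) - 1 / real CARD('v))"

lemma laplacian_row_sum: "(\<Sum>z\<in>UNIV. laplacian E $ x $ z) = 0"
  using laplacian_mult_vec[of x "\<lambda>_. 1"] by simp

lemma group_inverse_laplacian: "group_inverse (laplacian E) = green_matrix"
proof (rule symmetric_group_inverseI[where P = mean_free_projection])
  let ?n = "real CARD('v)"
  show "transpose (laplacian E) = laplacian E"
    by (rule transpose_laplacian)
  show "transpose mean_free_projection = mean_free_projection"
    by (auto simp: vec_eq_iff transpose_def mean_free_projection_def)
  show "laplacian E ** mean_free_projection = laplacian E"
  proof -
    have "(\<Sum>z\<in>UNIV. laplacian E $ x $ z * ((if z = y then 1 else 0) - 1 / ?n)) = laplacian E $ x $ y"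
      for x y
    proof -
      have "(\<Sum>z\<in>UNIV. laplacian E $ x $ z * ((if z = y then 1 else 0) - 1 / ?n)) =
          (\<Sum>z\<in>UNIV. (if z = y then laplacian E $ x $ z else 0)) - (\<Sum>z\<in>UNIV. laplacian E $ x $ z) * (1 / ?n)"
        unfolding sum_distrib_right sum_subtractf[symmetric]
        by (rule sum.cong) (auto simp: algebra_simps)
      then show ?thesis
        by (simp add: laplacian_row_sum)
    qed
    then show ?thesis
      by (simp add: vec_eq_iff matrix_matrix_mult_def mean_free_projection_def)
  qed
  show "laplacian E ** green_matrix = mean_free_projection"
  proof -
    have "(\<Sum>z\<in>UNIV. laplacian E $ x $ z * green_matrix $ z $ y) = mean_free_projection $ x $ y"
      for x y
    proof -
      let ?u = "\<lambda>z. green_potential (part_of y) (gdist E y z)"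
      \<comment> \<open>The shift \<open>m\<close> is constant along the column, so the zero row
        sums of the Laplacian remove it.\<close>
      define m where "m = 1 / ?n\<^sup>2 * sum ?u UNIV"
      have "(\<Sum>z\<in>UNIV. laplacian E $ x $ z * green_matrix $ z $ y) =
          (\<Sum>z\<in>UNIV. 1 / ?n * (laplacian E $ x $ z * ?u z) - laplacian E $ x $ z * m)"
        by (rule sum.cong) (simp_all add: green_matrix_def m_def right_diff_distrib)
      also have "\<dots> = 1 / ?n * (\<Sum>z\<in>UNIV. laplacian E $ x $ z * ?u z)
          - (\<Sum>z\<in>UNIV. laplacian E $ x $ z) * m"
        by (simp only: sum_subtractf sum_distrib_left sum_distrib_right)
      also have "\<dots> = 1 / ?n * ((if x = y then ?n else 0) - 1)"
        by (simp only: laplacian_row_sum laplacian_green_potential[OF part_of] mult_zero_left diff_zero)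
      also have "\<dots> = mean_free_projection $ x $ y"
        by (simp add: mean_free_projection_def right_diff_distrib)
      finally show ?thesis .
    qed
    then show ?thesis
      by (simp add: vec_eq_iff matrix_matrix_mult_def)
  qed
  show "mean_free_projection ** green_matrix = green_matrix"
  proof -
    have column_sum: "(\<Sum>z\<in>UNIV. green_matrix $ z $ y) = 0" for y
      by (simp add: green_matrix_def sum_subtractf power2_eq_square flip: sum_divide_distrib)
    have "(\<Sum>z\<in>UNIV. ((if x = z then 1 else 0) - 1 / ?n) * green_matrix $ z $ y) = green_matrix $ x $ y"
      for x y
    proof -
      have "(\<Sum>z\<in>UNIV. ((if x = z then 1 else 0) - 1 / ?n) * green_matrix $ z $ y) =
          (\<Sum>z\<in>UNIV. (if x = z then green_matrix $ z $ y else 0)) - 1 / ?n * (\<Sum>z\<in>UNIV. green_matrix $ z $ y)"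
        unfolding sum_distrib_left sum_subtractf[symmetric]
        by (rule sum.cong) (auto simp: algebra_simps)
      then show ?thesis
        by (simp add: column_sum)
    qed
    then show ?thesis
      by (simp add: vec_eq_iff matrix_matrix_mult_def mean_free_projection_def)
  qed
qed

end

theorem theorem3p8:
  fixes E :: "'v::finite \<Rightarrow> 'v \<Rightarrow> bool" and V :: "nat \<Rightarrow> 'v set"
    and n l :: nat and x y :: 'v
  assumes "n = CARD('v)" and "n \<ge> 2"
    and "distance_biregular E V"
    and "l \<in> {0, 1}" and "y \<in> V l"
  shows "group_inverse (laplacian E) $ x $ y =
    1 / real n * (\<Sum>j = gdist E x y + 1..diam_part E V l.
      (real n - real (B_num E V l (j - 1))) / (real (k_num E V l j) * real (c_num E V l j)))
    - 1 / (real n)\<^sup>2 * (\<Sum>j = 1..diam_part E V l.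
      real (B_num E V l (j - 1)) * (real n - real (B_num E V l (j - 1)))
        / (real (k_num E V l j) * real (c_num E V l j)))"
proof -
  interpret distance_biregular_graph E V
    by unfold_locales (rule assms(3))
  have "group_inverse (laplacian E) $ x $ y =
      1 / real n * green_potential l (gdist E y x)
      - 1 / (real n)\<^sup>2 * (\<Sum>z\<in>UNIV. green_potential l (gdist E y z))"
    by (simp add: group_inverse_laplacian green_matrix_def part_of_eq[OF assms(4,5)] assms(1))
  then show ?thesis
    unfolding sum_green_potential[OF assms(4,5)]
    \<comment> \<open>The potential measures distance from \<open>y\<close>, the claim from
      \<open>x\<close>.\<close>
    by (simp only: green_potential_def gdist_sym[of y x] times_divide_eq_right assms(1))
qed

end
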